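(* Let $D$ be a convex open set in $\mathbb{R}^2$ (which need not be bounded) with $C^4$ boundary. Let $p_0\in\partial D$, let $c\colon[0,L]\to\partial D$ have affine unit speed and $c(0)=p_0$, and let $\kappa$ be the affine curvature of $c$. Let $\bar\kappa\colon[0,L]\to\mathbb{R}$ be a continuous function such that the operator $\bar y\mapsto\bar y'''+\bar\kappa\,\bar y'$ has forward positive Lagrange kernel on $[0,L]$, and define $\bar A\colon[0,L]\to\mathbb{R}$ by the initial value problem $$\bar A'''+\bar\kappa\,\bar A'=\frac12,\qquad \bar A(0)=\bar A'(0)=\bar A''(0)=0.$$ Let $A(s)=\frac12\int_0^s(c(\sigma)-c(0))\wedge c'(\sigma)\,d\sigma$. Then $$\kappa(s)\le\bar\kappa(s)\text{ on }[0,L]\quad\text{implies}\quad A(L)\ge\bar A(L),$$ $$\kappa(s)\ge\bar\kappa(s)\text{ on }[0,L]\quad\text{implies}\quad A(L)\le\bar A(L).$$ In either of these cases, if equality $A(L)=\bar A(L)$ holds, then $\kappa\equiv\bar\kappa$ on $[0,L]$.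
   Context: For $v=(v_1,v_2),w=(w_1,w_2)\in\mathbb{R}^2$ put $v\wedge w=v_1w_2-v_2w_1$. A $C^3$ curve $c$ has affine unit speed if $c'(s)\wedge c''(s)=1$ for all $s$, and its affine curvature is the function $\kappa$ with $c'''(s)=-\kappa(s)c'(s)$. The Lagrange kernel of the operator $y\mapsto y'''+\bar\kappa y'$ on an interval $I$ is the function $K\colon I\times I\to\mathbb{R}$ such that for each $r\in I$, $s\mapsto K(s;r)$ solves $\partial_s^3K(s;r)+\bar\kappa(s)\,\partial_sK(s;r)=0$ with $K(r;r)=\partial_sK(r;r)=0$ and $\partial_s^2K(r;r)=1$. It is forward positive on $I$ if $K(s;r)\ge0$ for all $r,s\in I$ with $s>r$. *)

theory Defs
  imports "HOL-Analysis.Analysis"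
begin

definition wedge :: "real^2 \<Rightarrow> real^2 \<Rightarrow> real" where
  "wedge v w = v $ 1 * w $ 2 - v $ 2 * w $ 1"

text \<open>
  All derivatives are taken relative to a set \<open>S\<close>; on a closed interval of positive length
  they are the usual derivatives, one-sided at the end points.
\<close>

definition nth_deriv :: "nat \<Rightarrow> real set \<Rightarrow> (real \<Rightarrow> 'a::real_normed_vector) \<Rightarrow> real \<Rightarrow> 'a" where
  "nth_deriv k S f = ((\<lambda>g s. vector_derivative g (at s within S)) ^^ k) f"

definition times_differentiable_on ::
    "nat \<Rightarrow> (real \<Rightarrow> 'a::real_normed_vector) \<Rightarrow> real set \<Rightarrow> bool" where
  "times_differentiable_on k f S \<longleftrightarrow>
     (\<forall>i<k. \<forall>s\<in>S. nth_deriv i S f differentiable (at s within S))"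

definition C_on :: "nat \<Rightarrow> (real \<Rightarrow> 'a::real_normed_vector) \<Rightarrow> real set \<Rightarrow> bool" where
  "C_on k f S \<longleftrightarrow> times_differentiable_on k f S \<and> continuous_on S (nth_deriv k S f)"

text \<open>
  Near each boundary point, \<open>D\<close> is, in suitable orthonormal coordinates, the region strictly
  above the graph of a \<open>C\<^sup>k\<close> function. Translations are absorbed by the function \<open>g\<close>, and
  requiring \<open>g\<close> to be defined and \<open>C\<^sup>k\<close> on the whole line is no restriction, because the
  condition is local.
\<close>

definition C_boundary :: "nat \<Rightarrow> (real^2) set \<Rightarrow> bool" where
  "C_boundary k D \<longleftrightarrow>
     (\<forall>p\<in>frontier D. \<exists>U. \<exists>T :: real^2 \<Rightarrow> real^2. \<exists>g :: real \<Rightarrow> real.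
        open U \<and> p \<in> U \<and> orthogonal_transformation T \<and> C_on k g UNIV \<and>
        D \<inter> U = {x \<in> U. T x $ 2 > g (T x $ 1)})"

definition affine_unit_speed_on :: "(real \<Rightarrow> real^2) \<Rightarrow> real set \<Rightarrow> bool" where
  "affine_unit_speed_on c S \<longleftrightarrow>
     C_on 3 c S \<and> (\<forall>s\<in>S. wedge (nth_deriv 1 S c s) (nth_deriv 2 S c s) = 1)"

text \<open>
  The equation determines \<open>\<kappa>\<close> on \<open>S\<close>, since \<open>c'\<close> has no zeros for a curve of affine unit speed.
\<close>

definition is_affine_curvature :: "(real \<Rightarrow> real^2) \<Rightarrow> (real \<Rightarrow> real) \<Rightarrow> real set \<Rightarrow> bool" where
  "is_affine_curvature c \<kappa> S \<longleftrightarrow>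
     (\<forall>s\<in>S. nth_deriv 3 S c s = - (\<kappa> s) *\<^sub>R nth_deriv 1 S c s)"

definition solves_on ::
    "(real \<Rightarrow> real) \<Rightarrow> (real \<Rightarrow> real) \<Rightarrow> (real \<Rightarrow> real) \<Rightarrow> real set \<Rightarrow> bool" where
  \<comment> \<open>\<open>y''' + \<kappa> y' = f\<close> on \<open>I\<close>\<close>
  "solves_on \<kappa> f y I \<longleftrightarrow>
     times_differentiable_on 3 y I \<and>
     (\<forall>s\<in>I. nth_deriv 3 I y s + \<kappa> s * nth_deriv 1 I y s = f s)"

text \<open>
  The argument order is \<open>K s r\<close> for \<open>K(s;r)\<close>. For continuous \<open>\<kappa>\<close> and an interval \<open>I\<close> of positive
  length, the kernel exists and is unique on \<open>I \<times> I\<close>.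
\<close>

definition is_Lagrange_kernel ::
    "(real \<Rightarrow> real) \<Rightarrow> real set \<Rightarrow> (real \<Rightarrow> real \<Rightarrow> real) \<Rightarrow> bool" where
  "is_Lagrange_kernel \<kappa> I K \<longleftrightarrow>
     (\<forall>r\<in>I. solves_on \<kappa> (\<lambda>_. 0) (\<lambda>s. K s r) I \<and>
        K r r = 0 \<and> nth_deriv 1 I (\<lambda>s. K s r) r = 0 \<and> nth_deriv 2 I (\<lambda>s. K s r) r = 1)"

definition forward_positive :: "(real \<Rightarrow> real \<Rightarrow> real) \<Rightarrow> real set \<Rightarrow> bool" where
  "forward_positive K I \<longleftrightarrow> (\<forall>r\<in>I. \<forall>s\<in>I. s > r \<longrightarrow> K s r \<ge> 0)"

definition swept_area :: "real \<Rightarrow> (real \<Rightarrow> real^2) \<Rightarrow> real \<Rightarrow> real" where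
  "swept_area L c s =
     1/2 * integral {0..s} (\<lambda>\<sigma>. wedge (c \<sigma> - c 0) (nth_deriv 1 {0..L} c \<sigma>))"

end

theory Submission
  imports Defs
begin

text \<open>
  Differentiating the swept area \<open>A\<close> and using \<open>c' \<and> c'' = 1\<close> and \<open>c''' = - \<kappa> c'\<close> shows that its derivative
  \<open>a = (c - c(0)) \<and> c' / 2\<close> solves \<open>a'' + \<kappa> a = 1/2\<close> with \<open>a(0) = a'(0) = 0\<close>. The derivative of \<open>A\<^sub>b\<close> solves
  the same problem with \<open>\<kappa>\<^sub>b\<close> in place of \<open>\<kappa>\<close>. Hence \<open>w = (A - A\<^sub>b)'\<close> satisfies
  \<open>w'' + \<kappa>\<^sub>b w = (\<kappa>\<^sub>b - \<kappa>) a\<close> with zero initial data, and Duhamel's formula reads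
  \<open>A(L) - A\<^sub>b(L) = \<integral> (\<kappa>\<^sub>b(r) - \<kappa>(r)) a(r) K(L;r) dr\<close> over \<open>[0,L]\<close>. Both inequalities follow once the
  two factors next to \<open>\<kappa>\<^sub>b - \<kappa>\<close> are nonnegative. For \<open>K(L;r)\<close> this is forward positivity. For \<open>a(s)\<close> it
  says that \<open>c(0)\<close> lies on the left of the tangent line at \<open>c(s)\<close>, and this is where convexity enters
  (\<open>convex_boundary_arc_wedge_nonneg\<close>).

  The function \<open>y(r) = K(L;r)\<close> is reached through the adjoint problem: as a function of its second
  argument the kernel solves \<open>y'' + \<kappa>\<^sub>b y = 1\<close> with \<open>y(L) = y'(L) = 0\<close>. A solution of this problem is
  assembled from \<open>A\<^sub>b'\<close> and derivatives of kernel functions (\<open>oscillator_vanishing_at_right_end\<close>), so no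
  existence theorem for differential equations is involved. Lagrange's identity, in the form
  \<open>Green_identity\<close>, then yields both \<open>y(r) = K(L;r)\<close>, by taking \<open>K(\<cdot>;r)\<close> on \<open>[r,L]\<close>, and the formula
  above, by taking \<open>A - A\<^sub>b\<close> on \<open>[0,L]\<close>.

  If \<open>A(L) = A\<^sub>b(L)\<close>, the integrand is continuous, of constant sign and has integral zero, so it
  vanishes. The product \<open>a y\<close> is not identically zero on any interval of positive length, because each
  factor solves an equation \<open>v'' + k v = h\<close> with a nonzero constant \<open>h\<close>. Therefore \<open>\<kappa>\<^sub>b - \<kappa>\<close> vanishes on
  a dense set, and by continuity everywhere.
\<close>

text \<open>
  The equation \<open>v'' + k v = f\<close> as a first-order system; it is satisfied by the derivative \<open>v\<close> of a solution of
  \<open>V''' + k V' = f\<close>. Carrying \<open>v'\<close> as a separate function avoids iterated derivative operators, and all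
  derivatives are one-sided at the end points of an interval \<open>S\<close>.
\<close>

definition oscillator_on ::
    "(real \<Rightarrow> real) \<Rightarrow> (real \<Rightarrow> real) \<Rightarrow> (real \<Rightarrow> real) \<Rightarrow> (real \<Rightarrow> real) \<Rightarrow> real set \<Rightarrow> bool" where
  "oscillator_on k f v v' S \<longleftrightarrow>
     (\<forall>s\<in>S. (v has_real_derivative v' s) (at s within S) \<and>
            (v' has_real_derivative f s - k s * v s) (at s within S))"

section \<open>Iterated derivatives and the wedge product\<close>

lemma nth_deriv_0: "nth_deriv 0 S f = f"
  by (simp add: nth_deriv_def)

lemma nth_deriv_has_vector_derivative:
  assumes "times_differentiable_on k f S" and "i < k" and "s \<in> S"
  shows "(nth_deriv i S f has_vector_derivative nth_deriv (Suc i) S f s) (at s within S)"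
proof -
  have "nth_deriv i S f differentiable (at s within S)"
    using assms by (simp add: times_differentiable_on_def)
  then show ?thesis
    by (simp add: vector_derivative_works nth_deriv_def)
qed

lemma has_vector_derivative_wedge:
  assumes f: "(f has_vector_derivative f') (at s within S)"
    and g: "(g has_vector_derivative g') (at s within S)"
  shows "((\<lambda>t. wedge (f t) (g t)) has_real_derivative wedge f' (g s) + wedge (f s) g') (at s within S)"
proof -
  have "((\<lambda>t. f t $ i) has_real_derivative f' $ i) (at s within S)"
    and "((\<lambda>t. g t $ i) has_real_derivative g' $ i) (at s within S)" for i
    using bounded_linear.has_vector_derivative[OF bounded_linear_vec_nth] f g
    by (auto simp: has_real_derivative_iff_has_vector_derivative)
  then show ?thesis
    unfolding wedge_def by (auto intro!: derivative_eq_intros)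
qed

lemma continuous_on_wedge:
  assumes "continuous_on S f" and "continuous_on S g"
  shows "continuous_on S (\<lambda>t. wedge (f t) (g t))"
  using assms unfolding wedge_def by (intro continuous_intros)

lemma solves_on_has_derivatives:
  assumes "solves_on k f y S"
  shows "s \<in> S \<Longrightarrow> (y has_real_derivative nth_deriv 1 S y s) (at s within S)"
    and "oscillator_on k f (nth_deriv 1 S y) (nth_deriv 2 S y) S"
proof -
  have d: "(nth_deriv i S y has_real_derivative nth_deriv (Suc i) S y s) (at s within S)"
    if "i < 3" and "s \<in> S" for i s
    using assms that nth_deriv_has_vector_derivative[of 3 y S i s]
    by (simp add: solves_on_def has_real_derivative_iff_has_vector_derivative)
  show "s \<in> S \<Longrightarrow> (y has_real_derivative nth_deriv 1 S y s) (at s within S)"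
    using d[of 0] by (simp add: nth_deriv_0)
  have "nth_deriv 3 S y s = f s - k s * nth_deriv 1 S y s" if "s \<in> S" for s
    using assms that unfolding solves_on_def by (metis add_diff_cancel_right')
  then show "oscillator_on k f (nth_deriv 1 S y) (nth_deriv 2 S y) S"
    using d[of 1] d[of 2] by (simp add: oscillator_on_def numeral_2_eq_2 numeral_3_eq_3)
qed

section \<open>The equation \<open>v'' + k v = f\<close>\<close>

lemma oscillator_on_continuous:
  assumes "oscillator_on k f v v' S"
  shows "continuous_on S v"
  using assms unfolding oscillator_on_def
  by (meson DERIV_continuous continuous_on_eq_continuous_within)

lemma oscillator_on_add_scaled:
  assumes "oscillator_on k f v v' S" and "oscillator_on k g w w' S"
  shows "oscillator_on k (\<lambda>s. f s + a * g s) (\<lambda>s. v s + a * w s) (\<lambda>s. v' s + a * w' s) S"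
  unfolding oscillator_on_def
proof (intro ballI conjI)
  fix s assume s: "s \<in> S"
  show "((\<lambda>s. v s + a * w s) has_real_derivative v' s + a * w' s) (at s within S)"
    using assms s unfolding oscillator_on_def by (auto intro!: derivative_eq_intros)
  have "((\<lambda>s. v' s + a * w' s) has_real_derivative
          (f s - k s * v s) + a * (g s - k s * w s)) (at s within S)"
    using assms s unfolding oscillator_on_def by (auto intro!: derivative_eq_intros)
  then show "((\<lambda>s. v' s + a * w' s) has_real_derivative
      f s + a * g s - k s * (v s + a * w s)) (at s within S)"
    by (simp add: algebra_simps)
qed

lemma Wronskian_constant:
  assumes v: "oscillator_on k (\<lambda>_. 0) v v' {a..b}"
    and w: "oscillator_on k (\<lambda>_. 0) w w' {a..b}"
    and "r \<in> {a..b}" and "s \<in> {a..b}"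
  shows "v r * w' r - w r * v' r = v s * w' s - w s * v' s"
proof -
  have "((\<lambda>s. v s * w' s - w s * v' s) has_real_derivative 0) (at s within {a..b})"
    if s: "s \<in> {a..b}" for s
  proof -
    have d:
      "(v has_real_derivative v' s) (at s within {a..b})"
      "(w has_real_derivative w' s) (at s within {a..b})"
      "(v' has_real_derivative 0 - k s * v s) (at s within {a..b})"
      "(w' has_real_derivative 0 - k s * w s) (at s within {a..b})"
      using v w s unfolding oscillator_on_def by blast+
    from DERIV_diff[OF DERIV_mult[OF d(1,4)] DERIV_mult[OF d(2,3)]] show ?thesis
      by (simp add: algebra_simps)
  qed
  then obtain C where "\<And>s. s \<in> {a..b} \<Longrightarrow> v s * w' s - w s * v' s = C"
    using has_field_derivative_zero_constant[of "{a..b}" "\<lambda>s. v s * w' s - w s * v' s"]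
    by (auto simp: convex_real_interval)
  then show ?thesis
    using assms by simp
qed

text \<open>
  This is Lagrange's identity for the self-adjoint expression \<open>v'' + k v\<close>, integrated:
  \<open>(v' y - v y')' = f y - v\<close>, and the term \<open>v = V'\<close> is moved to the other side. The inhomogeneity \<open>1\<close> of
  \<open>y\<close> is what makes the end-point values of the antiderivative \<open>V\<close> appear.
\<close>

lemma Green_identity:
  assumes "a \<le> b" and "{a..b} \<subseteq> S"
    and V: "\<And>s. s \<in> S \<Longrightarrow> (V has_real_derivative v s) (at s within S)"
    and v: "oscillator_on k f v v' S"
    and y: "oscillator_on k (\<lambda>_. 1) y y' S"
  shows "((\<lambda>s. f s * y s) has_integral
            (V b - v b * y' b + v' b * y b) - (V a - v a * y' a + v' a * y a)) {a..b}"
proof (rule fundamental_theorem_of_calculus[OF \<open>a \<le> b\<close>])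
  fix s assume "s \<in> {a..b}"
  then have s: "s \<in> S"
    using assms by auto
  have d:
    "(v has_real_derivative v' s) (at s within S)"
    "(v' has_real_derivative f s - k s * v s) (at s within S)"
    "(y has_real_derivative y' s) (at s within S)"
    "(y' has_real_derivative 1 - k s * y s) (at s within S)"
    using v y s unfolding oscillator_on_def by blast+
  have "((\<lambda>s. V s - v s * y' s + v' s * y s) has_real_derivative f s * y s) (at s within S)"
    using DERIV_add[OF DERIV_diff[OF V[OF s] DERIV_mult[OF d(1,4)]] DERIV_mult[OF d(2,3)]]
    by (simp add: algebra_simps)
  then show "((\<lambda>s. V s - v s * y' s + v' s * y s) has_vector_derivative f s * y s)
      (at s within {a..b})"
    using has_vector_derivative_within_subset assms(2)
    by (simp add: has_real_derivative_iff_has_vector_derivative) blast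
qed

lemma derivative_of_locally_zero:
  fixes g :: "real \<Rightarrow> real"
  assumes "p < q" and "{p..q} \<subseteq> S" and x: "x \<in> {p..q}"
    and g: "(g has_real_derivative d) (at x within S)"
    and z: "\<And>x. x \<in> {p..q} \<Longrightarrow> g x = 0"
  shows "d = 0"
proof -
  have "(g has_vector_derivative d) (at x within {p..q})"
    using g assms(2) has_vector_derivative_within_subset
    by (auto simp: has_real_derivative_iff_has_vector_derivative)
  moreover have "(g has_vector_derivative 0) (at x within {p..q})"
    by (rule has_vector_derivative_transform[OF x z has_vector_derivative_const])
  ultimately show ?thesis
    using vector_derivative_unique_within_closed_interval[OF \<open>p < q\<close>, of x g d 0] x by simp
qed

text \<open>
  If \<open>v\<close> vanished on an interval, then so would \<open>v''\<close>, and the equation would give \<open>h = 0\<close>.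
\<close>

lemma forced_oscillator_not_identically_zero:
  assumes "p < q" and "{p..q} \<subseteq> S"
    and v: "oscillator_on k (\<lambda>_. h) v v' S" and "h \<noteq> 0"
  obtains x where "x \<in> {p..q}" and "v x \<noteq> 0"
proof (rule ccontr)
  assume "\<not> thesis"
  then have z: "\<And>x. x \<in> {p..q} \<Longrightarrow> v x = 0"
    using that by blast
  have "v' x = 0" if "x \<in> {p..q}" for x
    using derivative_of_locally_zero[OF assms(1,2) that, of v] z v that assms(2)
    by (auto simp: oscillator_on_def)
  moreover have p: "p \<in> {p..q}" "p \<in> S"
    using assms(1,2) by auto
  moreover have "(v' has_real_derivative h - k p * v p) (at p within S)"
    using v p(2) by (simp add: oscillator_on_def)
  ultimately have "h - k p * v p = 0"
    using derivative_of_locally_zero[OF assms(1,2)] by blast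
  with z[of p] assms show False
    by simp
qed

section \<open>The Lagrange kernel as a function of its second argument\<close>

lemma Lagrange_kernel_oscillator:
  assumes "is_Lagrange_kernel k S K" and "r \<in> S"
  shows "oscillator_on k (\<lambda>_. 0) (nth_deriv 1 S (\<lambda>s. K s r)) (nth_deriv 2 S (\<lambda>s. K s r)) S"
  using assms solves_on_has_derivatives(2) unfolding is_Lagrange_kernel_def by blast

text \<open>
  This replaces an existence theorem for the adjoint problem. Derivatives \<open>u\<^sub>r\<close> of the kernel functions
  \<open>K(\<cdot>;r)\<close> solve the homogeneous equation with \<open>u\<^sub>r(r) = 0\<close> and \<open>u\<^sub>r'(r) = 1\<close>. Two of them, \<open>u\<^sub>L\<close> and
  a suitable \<open>u\<^sub>r\<close>, are independent, so adding multiples of them to a given solution \<open>b\<close>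
  of the inhomogeneous equation prescribes both values at \<open>L\<close>.
\<close>

lemma oscillator_vanishing_at_right_end:
  assumes "0 < L" and K: "is_Lagrange_kernel k {0..L} K"
    and b: "oscillator_on k f b b' {0..L}"
  obtains y y' where "oscillator_on k f y y' {0..L}" and "y L = 0" and "y' L = 0"
proof -
  define u where "u r = nth_deriv 1 {0..L} (\<lambda>s. K s r)" for r
  define u' where "u' r = nth_deriv 2 {0..L} (\<lambda>s. K s r)" for r
  have u: "oscillator_on k (\<lambda>_. 0) (u r) (u' r) {0..L}" "u r r = 0" "u' r r = 1"
    if "r \<in> {0..L}" for r
    using Lagrange_kernel_oscillator[OF K that] K that
    by (simp_all add: u_def u'_def is_Lagrange_kernel_def)
  have L: "L \<in> {0..L}"
    using assms by simp
  \<comment> \<open>\<open>u L\<close> has slope 1 at \<open>L\<close> and so is not identically zero. A point \<open>r\<close> with \<open>u L r \<noteq> 0\<close>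
    makes the Wronskian of \<open>u r\<close> and \<open>u L\<close> nonzero, and at \<open>L\<close> this Wronskian is \<open>u r L\<close>.\<close>
  obtain r where r: "r \<in> {0..L}" "u L r \<noteq> 0"
  proof (rule ccontr)
    assume "\<not> thesis"
    then have z: "\<And>r. r \<in> {0..L} \<Longrightarrow> u L r = 0"
      using that by blast
    have "(u L has_real_derivative 1) (at L within {0..L})"
      using u[OF L] L unfolding oscillator_on_def by metis
    then have "(1::real) = 0"
      using derivative_of_locally_zero[OF \<open>0 < L\<close> subset_refl L, of "u L"] z by blast
    then show False
      by simp
  qed
  have uL: "u r L \<noteq> 0"
    using Wronskian_constant[OF u(1)[OF r(1)] u(1)[OF L] r(1) L] u[OF L] u[OF r(1)] r(2) by simp
  \<comment> \<open>As \<open>u L\<close> vanishes at \<open>L\<close>, the value at \<open>L\<close> is corrected by \<open>u r\<close> alone; then the slope is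
    corrected by \<open>u L\<close>.\<close>
  define \<alpha> where "\<alpha> = - b L / u r L"
  define \<gamma> where "\<gamma> = - (b' L + \<alpha> * u' r L)"
  have "oscillator_on k (\<lambda>s. (f s + \<alpha> * 0) + \<gamma> * 0) (\<lambda>s. (b s + \<alpha> * u r s) + \<gamma> * u L s)
      (\<lambda>s. (b' s + \<alpha> * u' r s) + \<gamma> * u' L s) {0..L}"
    by (rule oscillator_on_add_scaled[OF oscillator_on_add_scaled[OF b u(1)[OF r(1)]] u(1)[OF L]])
  then show thesis
    by (intro that[of "\<lambda>s. (b s + \<alpha> * u r s) + \<gamma> * u L s" "\<lambda>s. (b' s + \<alpha> * u' r s) + \<gamma> * u' L s"])
      (use uL u[OF L] in \<open>simp_all add: \<alpha>_def \<gamma>_def\<close>)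
qed

text \<open>
  The Green identity on \<open>[r,L]\<close> for the solution \<open>K(\<cdot>;r)\<close> of the homogeneous equation has only two
  surviving boundary terms: \<open>K(L;r)\<close> at \<open>L\<close>, where \<open>y\<close> and \<open>y'\<close> vanish, and \<open>y(r)\<close> at \<open>r\<close>, from the
  initial values of the kernel.
\<close>

lemma Lagrange_kernel_at_right_end:
  assumes K: "is_Lagrange_kernel k {0..L} K" and r: "r \<in> {0..L}"
    and y: "oscillator_on k (\<lambda>_. 1) y y' {0..L}" "y L = 0" "y' L = 0"
  shows "K L r = y r"
proof -
  have s: "solves_on k (\<lambda>_. 0) (\<lambda>s. K s r) {0..L}"
    and i: "K r r = 0" "nth_deriv 1 {0..L} (\<lambda>s. K s r) r = 0" "nth_deriv 2 {0..L} (\<lambda>s. K s r) r = 1"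
    using K r unfolding is_Lagrange_kernel_def by auto
  have "((\<lambda>s. 0 * y s) has_integral (K L r - y r)) {r..L}"
    using Green_identity[OF _ _ solves_on_has_derivatives[OF s] y(1), of r L] r y(2,3) i by simp
  then show ?thesis
    by simp
qed

section \<open>The swept area of a convex boundary arc\<close>

text \<open>
  A vector orthogonal to \<open>v\<close> is a multiple of \<open>v\<close> rotated by a right angle, so it acts as a multiple of
  \<open>wedge v\<close>; the normalisation by \<open>w\<close> identifies the factor.
\<close>

lemma wedge_inner_identity:
  fixes a v w z :: "real^2"
  assumes "a \<bullet> v = 0" and "wedge v w = 1"
  shows "a \<bullet> z = (a \<bullet> w) * wedge v z"
proof -
  have a: "a $ 1 * v $ 1 + a $ 2 * v $ 2 = 0" and w: "v $ 1 * w $ 2 - v $ 2 * w $ 1 = 1"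
    using assms by (simp_all add: inner_vec_def sum_2 wedge_def)
  have "(a $ 1 * w $ 1 + a $ 2 * w $ 2) * (v $ 1 * z $ 2 - v $ 2 * z $ 1)
      = a $ 1 * z $ 1 + a $ 2 * z $ 2"
    using a w by algebra
  then show ?thesis
    by (simp add: inner_vec_def sum_2 wedge_def)
qed

lemma second_derivative_nonpos_at_max:
  fixes g g' :: "real \<Rightarrow> real"
  assumes s: "s \<in> {a<..<b}"
    and g: "\<And>t. t \<in> {a<..<b} \<Longrightarrow> (g has_real_derivative g' t) (at t)"
    and g': "(g' has_real_derivative m) (at s)"
    and max: "\<And>t. t \<in> {a<..<b} \<Longrightarrow> g t \<le> g s"
  shows "g' s = 0" and "m \<le> 0"
proof -
  define e where "e = min (s - a) (b - s)"
  have e: "0 < e" "\<And>t. \<bar>s - t\<bar> < e \<Longrightarrow> t \<in> {a<..<b}"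
    using s by (auto simp: e_def)
  show g0: "g' s = 0"
    using DERIV_local_max[OF g[OF s] e(1)] e(2) max by blast
  show "m \<le> 0"
  proof (rule ccontr)
    assume "\<not> m \<le> 0"
    then obtain d where d: "d > 0" "\<And>h. 0 < h \<Longrightarrow> h < d \<Longrightarrow> g' s < g' (s + h)"
      using DERIV_pos_inc_right[OF g'] by auto
    define h where "h = min d e / 2"
    have h: "0 < h" "h < d" "h < e"
      using d(1) e(1) by (auto simp: h_def)
    have "\<exists>z. s < z \<and> z < s + h \<and> g (s + h) - g s = (s + h - s) * g' z"
      by (rule MVT2) (use h e(2) g in auto)
    then obtain z where z: "s < z" "z < s + h" "g (s + h) - g s = h * g' z"
      by auto
    have "0 < g' z"
      using d(2)[of "z - s"] z h g0 by simp
    with h have "0 < h * g' z"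
      by simp
    with z have "g s < g (s + h)"
      by simp
    moreover have "g (s + h) \<le> g s"
      using max e(2)[of "s + h"] h by simp
    ultimately show False
      by simp
  qed
qed

lemma frontier_open_convex_supporting_functional:
  fixes D :: "'a::euclidean_space set"
  assumes "open D" and "convex D" and "x \<in> frontier D"
  obtains a where "a \<noteq> 0" and "\<And>z. z \<in> frontier D \<Longrightarrow> a \<bullet> z \<le> a \<bullet> x"
proof -
  have x: "x \<notin> D" and ne: "D \<noteq> {}"
    using assms by (auto simp: frontier_def interior_open)
  obtain a b where a: "a \<noteq> 0" "\<forall>z\<in>D. a \<bullet> z \<le> b" "\<forall>z\<in>{x}. a \<bullet> z \<ge> b"
    using separating_hyperplane_sets[of D "{x}"] assms x ne by auto
  have "closure D \<subseteq> {z. a \<bullet> z \<le> b}"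
    by (rule closure_minimal) (use a in \<open>auto simp: closed_halfspace_le\<close>)
  then show thesis
    using a by (intro that[of a]) (auto simp: frontier_def)
qed

text \<open>
  A linear functional \<open>a\<close> supporting \<open>D\<close> at \<open>c(s)\<close> attains its maximum along the arc there. At an
  interior parameter the first derivative test makes \<open>a\<close> a multiple of \<open>wedge (c' s)\<close>, with factor
  \<open>a \<bullet> c'' s\<close> because \<open>c' \<and> c'' = 1\<close>, and the second derivative test with \<open>a \<noteq> 0\<close> makes this factor
  negative. So
  the whole arc lies in \<open>wedge (c' s) (z - c s) \<ge> 0\<close>. The two end parameters follow by continuity.
\<close>

lemma convex_boundary_arc_wedge_nonneg:
  assumes "open D" and "convex D" and "L > 0"
    and im: "c ` {0..L} \<subseteq> frontier D"
    and c1: "\<And>s. s \<in> {0..L} \<Longrightarrow> (c has_vector_derivative c' s) (at s within {0..L})"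
    and c2: "\<And>s. s \<in> {0..L} \<Longrightarrow> (c' has_vector_derivative c'' s) (at s within {0..L})"
    and unit: "\<And>s. s \<in> {0..L} \<Longrightarrow> wedge (c' s) (c'' s) = 1"
    and s: "s \<in> {0..L}" and t: "t \<in> {0..L}"
  shows "wedge (c s - c t) (c' s) \<ge> 0"
proof -
  have interior: "wedge (c s - c t) (c' s) \<ge> 0" if s: "s \<in> {0<..<L}" for s
  proof -
    have "c s \<in> frontier D"
      using im s by auto
    then obtain a where a: "a \<noteq> 0" "\<And>z. z \<in> frontier D \<Longrightarrow> a \<bullet> z \<le> a \<bullet> c s"
      using frontier_open_convex_supporting_functional assms(1,2) by metis
    have d: "((\<lambda>t. a \<bullet> c t) has_real_derivative a \<bullet> c' t) (at t)"
        "((\<lambda>t. a \<bullet> c' t) has_real_derivative a \<bullet> c'' t) (at t)" if "t \<in> {0<..<L}" for t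
    proof -
      have at: "at t within {0..L} = at t"
        using that by (intro at_within_interior) auto
      show "((\<lambda>t. a \<bullet> c t) has_real_derivative a \<bullet> c' t) (at t)"
        "((\<lambda>t. a \<bullet> c' t) has_real_derivative a \<bullet> c'' t) (at t)"
        using bounded_linear.has_vector_derivative[OF bounded_linear_inner_right] c1[of t] c2[of t] that
        by (auto simp: has_real_derivative_iff_has_vector_derivative at)
    qed
    have orth: "a \<bullet> c' s = 0" and le: "a \<bullet> c'' s \<le> 0"
      using second_derivative_nonpos_at_max[OF s d(1) d(2)[OF s]] a(2) im by (auto simp: image_subset_iff)
    have eq: "a \<bullet> z = (a \<bullet> c'' s) * wedge (c' s) z" for z
      using s by (intro wedge_inner_identity[OF orth unit]) simp
    have "a \<bullet> c'' s \<noteq> 0"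
      using eq[of a] a(1) by auto
    moreover have "a \<bullet> (c t - c s) \<le> 0"
      using a(2)[of "c t"] im t by (simp add: inner_diff_right image_subset_iff)
    ultimately have "wedge (c' s) (c t - c s) \<ge> 0"
      using eq[of "c t - c s"] le by (simp add: mult_le_0_iff)
    then show ?thesis
      by (simp add: wedge_def algebra_simps)
  qed
  have "continuous_on {0..L} c" and "continuous_on {0..L} c'"
    using has_vector_derivative_continuous[OF c1] has_vector_derivative_continuous[OF c2]
    by (simp_all add: continuous_on_eq_continuous_within)
  then have cont: "continuous_on {0..L} (\<lambda>s. wedge (c s - c t) (c' s))"
    by (intro continuous_on_wedge continuous_intros)
  have "continuous_on (closure {0<..<L}) (\<lambda>s. wedge (c s - c t) (c' s))"
    using cont \<open>L > 0\<close> by simp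
  then show ?thesis
    by (rule continuous_ge_on_closure) (use interior s \<open>L > 0\<close> in auto)
qed

lemma affine_unit_speed_derivatives:
  assumes "affine_unit_speed_on c S" and "s \<in> S"
  shows "(c has_vector_derivative nth_deriv 1 S c s) (at s within S)"
    and "(nth_deriv 1 S c has_vector_derivative nth_deriv 2 S c s) (at s within S)"
    and "(nth_deriv 2 S c has_vector_derivative nth_deriv 3 S c s) (at s within S)"
    and "wedge (nth_deriv 1 S c s) (nth_deriv 2 S c s) = 1"
proof -
  have "times_differentiable_on 3 c S"
    using assms by (simp add: affine_unit_speed_on_def C_on_def)
  note d = nth_deriv_has_vector_derivative[OF this _ assms(2)]
  show "(c has_vector_derivative nth_deriv 1 S c s) (at s within S)"
    using d[of 0] by (simp add: nth_deriv_0)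
  show "(nth_deriv 1 S c has_vector_derivative nth_deriv 2 S c s) (at s within S)"
    using d[of 1] by (simp add: numeral_2_eq_2)
  show "(nth_deriv 2 S c has_vector_derivative nth_deriv 3 S c s) (at s within S)"
    using d[of 2] by (simp add: numeral_3_eq_3)
  show "wedge (nth_deriv 1 S c s) (nth_deriv 2 S c s) = 1"
    using assms by (simp add: affine_unit_speed_on_def)
qed

text \<open>
  Pairing \<open>c''' = - \<kappa> c'\<close> with \<open>c''\<close> expresses the curvature as \<open>\<kappa> = c'' \<and> c'''\<close>.
\<close>

lemma affine_curvature_continuous:
  assumes c: "affine_unit_speed_on c S" and \<kappa>: "is_affine_curvature c \<kappa> S"
  shows "continuous_on S \<kappa>"
proof -
  have "\<kappa> s = wedge (nth_deriv 2 S c s) (nth_deriv 3 S c s)" if "s \<in> S" for s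
  proof -
    have "nth_deriv 3 S c s = - \<kappa> s *\<^sub>R nth_deriv 1 S c s"
      using \<kappa> that by (simp add: is_affine_curvature_def)
    then have "wedge (nth_deriv 2 S c s) (nth_deriv 3 S c s)
        = \<kappa> s * wedge (nth_deriv 1 S c s) (nth_deriv 2 S c s)"
      by (simp add: wedge_def algebra_simps)
    then show ?thesis
      using affine_unit_speed_derivatives(4)[OF c that] by simp
  qed
  moreover have "continuous_on S (nth_deriv 2 S c)"
    using affine_unit_speed_derivatives(3)[OF c]
    by (meson has_vector_derivative_continuous continuous_on_eq_continuous_within)
  moreover have "continuous_on S (nth_deriv 3 S c)"
    using c by (simp add: affine_unit_speed_on_def C_on_def)
  ultimately show ?thesis
    using continuous_on_wedge by (simp cong: continuous_on_cong)
qed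

text \<open>
  In \<open>((c - c(0)) \<and> c'')' = c' \<and> c'' + (c - c(0)) \<and> c'''\<close> the first term is \<open>1\<close> by affine unit speed
  and the second is \<open>- \<kappa>\<close> times \<open>(c - c(0)) \<and> c'\<close>. In the first derivative the corresponding term
  \<open>c' \<and> c'\<close> is zero.
\<close>

lemma swept_area_oscillator:
  assumes c: "affine_unit_speed_on c {0..L}" and \<kappa>: "is_affine_curvature c \<kappa> {0..L}"
  defines "a \<equiv> \<lambda>s. wedge (c s - c 0) (nth_deriv 1 {0..L} c s) / 2"
    and "a' \<equiv> \<lambda>s. wedge (c s - c 0) (nth_deriv 2 {0..L} c s) / 2"
  shows "s \<in> {0..L} \<Longrightarrow> (swept_area L c has_real_derivative a s) (at s within {0..L})"
    and "oscillator_on \<kappa> (\<lambda>_. 1/2) a a' {0..L}"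
proof -
  note d = affine_unit_speed_derivatives[OF c]
  have d0: "((\<lambda>s. c s - c 0) has_vector_derivative nth_deriv 1 {0..L} c s) (at s within {0..L})"
    if "s \<in> {0..L}" for s
    using d(1)[OF that] by (auto intro!: derivative_eq_intros)
  show osc: "oscillator_on \<kappa> (\<lambda>_. 1/2) a a' {0..L}"
    unfolding oscillator_on_def
  proof (intro ballI conjI)
    fix s assume s: "s \<in> {0..L}"
    show "(a has_real_derivative a' s) (at s within {0..L})"
      using DERIV_cdivide[OF has_vector_derivative_wedge[OF d0[OF s] d(2)[OF s]], of 2]
      by (simp add: a_def a'_def wedge_def)
    have "nth_deriv 3 {0..L} c s = - \<kappa> s *\<^sub>R nth_deriv 1 {0..L} c s"
      using \<kappa> s by (simp add: is_affine_curvature_def)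
    then show "(a' has_real_derivative 1/2 - \<kappa> s * a s) (at s within {0..L})"
      using DERIV_cdivide[OF has_vector_derivative_wedge[OF d0[OF s] d(3)[OF s]], of 2] d(4)[OF s]
      by (simp add: a_def a'_def wedge_def field_simps)
  qed
  assume s: "s \<in> {0..L}"
  have "continuous_on {0..L} (\<lambda>s. 2 * a s)"
    using oscillator_on_continuous[OF osc] by (intro continuous_intros)
  from DERIV_cmult[OF integral_has_real_derivative[OF this s], of "1/2"]
  show "(swept_area L c has_real_derivative a s) (at s within {0..L})"
    by (simp add: swept_area_def[abs_def] a_def)
qed

section \<open>Comparison\<close>

lemma continuous_nonzero_subinterval:
  fixes g :: "real \<Rightarrow> real"
  assumes g: "continuous_on {p..q} g" and "p < q" and s: "s \<in> {p..q}" "g s \<noteq> 0"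
  obtains p' q' where "p' < q'" and "{p'..q'} \<subseteq> {p..q}" and "\<And>x. x \<in> {p'..q'} \<Longrightarrow> g x \<noteq> 0"
proof -
  obtain e where e: "e > 0" "\<And>x. x \<in> {p..q} \<Longrightarrow> dist x s < e \<Longrightarrow> dist (g x) (g s) < \<bar>g s\<bar>"
    using g s unfolding continuous_on_iff by (metis zero_less_abs_iff)
  have nz: "g x \<noteq> 0" if "x \<in> {p..q}" "\<bar>x - s\<bar> < e" for x
    using e(2)[of x] that by (auto simp: dist_real_def)
  define p' q' where "p' = max p (s - e/2)" and "q' = min q (s + e/2)"
  show thesis
  proof (rule that[of p' q'])
    show "p' < q'" and sub: "{p'..q'} \<subseteq> {p..q}"
      using e(1) s \<open>p < q\<close> by (auto simp: p'_def q'_def)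
    show "g x \<noteq> 0" if "x \<in> {p'..q'}" for x
      using that sub e(1) by (intro nz) (auto simp: p'_def q'_def)
  qed
qed

text \<open>
  A weight \<open>m\<close> that may vanish, but on no interval, still detects where a nonnegative continuous \<open>d\<close>
  is positive: a positive value of \<open>d\<close> persists on an interval, which contains a point with \<open>m > 0\<close>.
\<close>

lemma weighted_integral_nonneg_zero_iff:
  fixes d m :: "real \<Rightarrow> real"
  assumes "a < b" and d: "continuous_on {a..b} d" and m: "continuous_on {a..b} m"
    and d0: "\<And>x. x \<in> {a..b} \<Longrightarrow> d x \<ge> 0" and m0: "\<And>x. x \<in> {a..b} \<Longrightarrow> m x \<ge> 0"
    and dense: "\<And>p q. p < q \<Longrightarrow> {p..q} \<subseteq> {a..b} \<Longrightarrow> \<exists>x\<in>{p..q}. m x \<noteq> 0"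
    and I: "((\<lambda>x. d x * m x) has_integral I) {a..b}"
  shows "I \<ge> 0" and "I = 0 \<Longrightarrow> x \<in> {a..b} \<Longrightarrow> d x = 0"
proof -
  show "I \<ge> 0"
    using I d0 m0 by (intro has_integral_nonneg[OF I]) auto
  assume "I = 0" and x: "x \<in> {a..b}"
  have "continuous_on {a..b} (\<lambda>x. d x * m x)"
    using d m by (intro continuous_intros)
  then have z: "d x * m x = 0" if "x \<in> {a..b}" for x
    using has_integral_0_cbox_imp_0[of a b "\<lambda>x. d x * m x" x] I \<open>I = 0\<close> d0 m0 \<open>a < b\<close> that by auto
  show "d x = 0"
  proof (rule ccontr)
    assume "d x \<noteq> 0"
    then obtain p q where "p < q" "{p..q} \<subseteq> {a..b}" "\<And>x. x \<in> {p..q} \<Longrightarrow> d x \<noteq> 0"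
      using continuous_nonzero_subinterval[OF d \<open>a < b\<close> x] by metis
    with dense[of p q] z show False
      by (metis mult_eq_0_iff subsetD)
  qed
qed

text \<open>
  The two factors are treated in succession: the first is nonzero on some subinterval, and there the
  second is nonzero at some point.
\<close>

lemma product_of_forced_oscillators_not_identically_zero:
  assumes "p < q" and "{p..q} \<subseteq> S"
    and v: "oscillator_on k (\<lambda>_. h) v v' S" and "h \<noteq> 0"
    and w: "oscillator_on l (\<lambda>_. j) w w' S" and "j \<noteq> 0"
  shows "\<exists>x\<in>{p..q}. v x * w x \<noteq> 0"
proof -
  obtain x where x: "x \<in> {p..q}" "v x \<noteq> 0"
    using forced_oscillator_not_identically_zero[OF assms(1,2) v \<open>h \<noteq> 0\<close>] by metis
  have "continuous_on {p..q} v"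
    using oscillator_on_continuous[OF v] assms(2) continuous_on_subset by blast
  then obtain p' q' where pq: "p' < q'" "{p'..q'} \<subseteq> {p..q}" "\<And>x. x \<in> {p'..q'} \<Longrightarrow> v x \<noteq> 0"
    using continuous_nonzero_subinterval[of p q v x] \<open>p < q\<close> x by metis
  obtain z where "z \<in> {p'..q'}" "w z \<noteq> 0"
    using forced_oscillator_not_identically_zero[OF pq(1) _ w \<open>j \<noteq> 0\<close>] pq(2) assms(2)
    by (metis subset_trans)
  with pq show ?thesis
    by (intro bexI[of _ z]) auto
qed

theorem theorem4p1:
  fixes D :: "(real^2) set" and p\<^sub>0 :: "real^2" and L :: real
    and c :: "real \<Rightarrow> real^2" and \<kappa> \<kappa>\<^sub>b A\<^sub>b :: "real \<Rightarrow> real"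
    and K :: "real \<Rightarrow> real \<Rightarrow> real"
  assumes "open D" and "convex D" and "C_boundary 4 D"
    and "p\<^sub>0 \<in> frontier D"
    and "L > 0"
    and "c ` {0..L} \<subseteq> frontier D"
    and "affine_unit_speed_on c {0..L}"
    and "c 0 = p\<^sub>0"
    and "is_affine_curvature c \<kappa> {0..L}"
    and "continuous_on {0..L} \<kappa>\<^sub>b"
    and "is_Lagrange_kernel \<kappa>\<^sub>b {0..L} K"
    and "forward_positive K {0..L}"
    and "solves_on \<kappa>\<^sub>b (\<lambda>_. 1/2) A\<^sub>b {0..L}"
    and "A\<^sub>b 0 = 0" and "nth_deriv 1 {0..L} A\<^sub>b 0 = 0" and "nth_deriv 2 {0..L} A\<^sub>b 0 = 0"
  shows "((\<forall>s\<in>{0..L}. \<kappa> s \<le> \<kappa>\<^sub>b s) \<longrightarrow> swept_area L c L \<ge> A\<^sub>b L) \<and>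
         ((\<forall>s\<in>{0..L}. \<kappa> s \<ge> \<kappa>\<^sub>b s) \<longrightarrow> swept_area L c L \<le> A\<^sub>b L) \<and>
         (((\<forall>s\<in>{0..L}. \<kappa> s \<le> \<kappa>\<^sub>b s) \<or> (\<forall>s\<in>{0..L}. \<kappa> s \<ge> \<kappa>\<^sub>b s)) \<and>
            swept_area L c L = A\<^sub>b L \<longrightarrow> (\<forall>s\<in>{0..L}. \<kappa> s = \<kappa>\<^sub>b s))"
proof -
  let ?I = "{0..L}"
  let ?A = "swept_area L c"
  note c = \<open>affine_unit_speed_on c ?I\<close>
  note K = \<open>is_Lagrange_kernel \<kappa>\<^sub>b ?I K\<close>
  note Ab = solves_on_has_derivatives[OF \<open>solves_on \<kappa>\<^sub>b (\<lambda>_. 1/2) A\<^sub>b ?I\<close>]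
  define a where "a = (\<lambda>s. wedge (c s - c 0) (nth_deriv 1 ?I c s) / 2)"
  define a' where "a' = (\<lambda>s. wedge (c s - c 0) (nth_deriv 2 ?I c s) / 2)"
  define b where "b = nth_deriv 1 ?I A\<^sub>b"
  define b' where "b' = nth_deriv 2 ?I A\<^sub>b"
  note A' = swept_area_oscillator[OF c \<open>is_affine_curvature c \<kappa> ?I\<close>]
  have A: "\<And>s. s \<in> ?I \<Longrightarrow> (?A has_real_derivative a s) (at s within ?I)"
      "oscillator_on \<kappa> (\<lambda>_. 1/2) a a' ?I"
    unfolding a_def a'_def using A' by blast+
  have b: "oscillator_on \<kappa>\<^sub>b (\<lambda>_. 1/2) b b' ?I"
    using Ab(2) by (simp add: b_def b'_def)
  have init: "?A 0 = 0" "a 0 = 0" "a' 0 = 0" "b 0 = 0" "b' 0 = 0"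
    using assms(15,16) by (simp_all add: swept_area_def a_def a'_def b_def b'_def wedge_def)

  \<comment> \<open>The adjoint problem has right-hand side 1, twice that of \<open>b\<close>.\<close>
  have "oscillator_on \<kappa>\<^sub>b (\<lambda>_. 1) (\<lambda>s. b s + 1 * b s) (\<lambda>s. b' s + 1 * b' s) ?I"
    using oscillator_on_add_scaled[OF b b, of 1] by simp
  from oscillator_vanishing_at_right_end[OF \<open>L > 0\<close> K this]
  obtain y y' where y: "oscillator_on \<kappa>\<^sub>b (\<lambda>_. 1) y y' ?I" "y L = 0" "y' L = 0"
    by metis
  have y0: "y r \<ge> 0" if r: "r \<in> ?I" for r
  proof (cases "r = L")
    case False
    then have "K L r \<ge> 0"
      using \<open>forward_positive K ?I\<close> r by (auto simp: forward_positive_def)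
    then show ?thesis
      using Lagrange_kernel_at_right_end[OF K r y] by simp
  qed (simp add: y)
  have a0: "a s \<ge> 0" if "s \<in> ?I" for s
    using convex_boundary_arc_wedge_nonneg[OF \<open>open D\<close> \<open>convex D\<close> \<open>L > 0\<close> \<open>c ` ?I \<subseteq> frontier D\<close>
        affine_unit_speed_derivatives(1,2,4)[OF c] that, of 0] \<open>L > 0\<close>
    by (simp add: a_def)

  define w where "w = (\<lambda>s. a s - b s)"
  define w' where "w' = (\<lambda>s. a' s - b' s)"
  have w: "oscillator_on \<kappa>\<^sub>b (\<lambda>s. (\<kappa>\<^sub>b s - \<kappa> s) * a s) w w' ?I"
    unfolding oscillator_on_def
  proof (intro ballI conjI)
    fix s assume s: "s \<in> ?I"
    show "(w has_real_derivative w' s) (at s within ?I)"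
      using A(2) b s unfolding w_def w'_def oscillator_on_def by (auto intro!: derivative_eq_intros)
    have "(w' has_real_derivative (1/2 - \<kappa> s * a s) - (1/2 - \<kappa>\<^sub>b s * b s)) (at s within ?I)"
      using A(2) b s unfolding w'_def oscillator_on_def by (intro DERIV_diff) auto
    then show "(w' has_real_derivative (\<kappa>\<^sub>b s - \<kappa> s) * a s - \<kappa>\<^sub>b s * w s) (at s within ?I)"
      by (simp add: w_def algebra_simps)
  qed
  have W: "((\<lambda>s. ?A s - A\<^sub>b s) has_real_derivative w s) (at s within ?I)" if "s \<in> ?I" for s
    using DERIV_diff[OF A(1)[OF that] Ab(1)[OF that]] by (simp add: w_def b_def)
  have diff: "((\<lambda>s. (\<kappa>\<^sub>b s - \<kappa> s) * (a s * y s)) has_integral ?A L - A\<^sub>b L) ?I"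
    using Green_identity[OF _ _ W w y(1), of 0 L] \<open>L > 0\<close> \<open>A\<^sub>b 0 = 0\<close> init y(2,3)
    by (simp add: w_def w'_def mult.assoc)
  have diff': "((\<lambda>s. (\<kappa> s - \<kappa>\<^sub>b s) * (a s * y s)) has_integral A\<^sub>b L - ?A L) ?I"
    using has_integral_neg[OF diff] by (simp add: algebra_simps)

  have \<kappa>: "continuous_on ?I \<kappa>"
    using affine_curvature_continuous[OF c \<open>is_affine_curvature c \<kappa> ?I\<close>] .
  have d: "continuous_on ?I (\<lambda>s. \<kappa>\<^sub>b s - \<kappa> s)" "continuous_on ?I (\<lambda>s. \<kappa> s - \<kappa>\<^sub>b s)"
    using \<kappa> \<open>continuous_on ?I \<kappa>\<^sub>b\<close> by (intro continuous_intros; simp)+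
  have m: "continuous_on ?I (\<lambda>s. a s * y s)"
    using oscillator_on_continuous[OF A(2)] oscillator_on_continuous[OF y(1)]
    by (intro continuous_intros)
  have m0: "a s * y s \<ge> 0" if "s \<in> ?I" for s
    using a0[OF that] y0[OF that] by simp
  have dense: "\<exists>x\<in>{p..q}. a x * y x \<noteq> 0" if "p < q" "{p..q} \<subseteq> ?I" for p q
    using product_of_forced_oscillators_not_identically_zero[OF that A(2) _ y(1)] by simp
  note le = weighted_integral_nonneg_zero_iff[OF \<open>L > 0\<close> d(1) m _ m0 dense diff]
  note ge = weighted_integral_nonneg_zero_iff[OF \<open>L > 0\<close> d(2) m _ m0 dense diff']
  show ?thesis
  proof (intro conjI impI)
    assume "\<forall>s\<in>?I. \<kappa> s \<le> \<kappa>\<^sub>b s"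
    with le(1) show "?A L \<ge> A\<^sub>b L"
      by simp
  next
    assume "\<forall>s\<in>?I. \<kappa> s \<ge> \<kappa>\<^sub>b s"
    with ge(1) show "?A L \<le> A\<^sub>b L"
      by simp
  next
    assume "((\<forall>s\<in>?I. \<kappa> s \<le> \<kappa>\<^sub>b s) \<or> (\<forall>s\<in>?I. \<kappa> s \<ge> \<kappa>\<^sub>b s)) \<and> ?A L = A\<^sub>b L"
    then show "\<forall>s\<in>?I. \<kappa> s = \<kappa>\<^sub>b s"
      using le(2) ge(2) by (metis (no_types, lifting) diff_ge_0_iff_ge eq_iff_diff_eq_0)
  qed
qed

end
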